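(* Let $n\ge1$ and let $\mathbb{B}$ be the open unit ball of $\mathbb{C}^n$. There exists a positive integer $M=M(n)$, depending only on $n$, with the following property: for every normal function $\mu$ on $[0,1)$ there exist functions $f_1,\dots,f_M\in H^\infty_\mu$ and a constant $C>0$ such that $$\sum_{i=1}^M |f_i(z)|\ \ge\ \frac{C}{\mu(|z|)}\qquad\text{for all } z\in\mathbb{B}.$$
   Context: A positive continuous function $\mu$ on $[0,1)$ is called normal if there exist numbers $0<\alpha<\beta$ and $\delta\in(0,1)$ such that $\frac{\mu(r)}{(1-r)^\alpha}$ is decreasing on $[\delta,1)$ with $\lim_{r\to1}\frac{\mu(r)}{(1-r)^\alpha}=0$, and $\frac{\mu(r)}{(1-r)^\beta}$ is increasing on $[\delta,1)$ with $\lim_{r\to1}\frac{\mu(r)}{(1-r)^\beta}=\infty$. The weighted-type space $H^\infty_\mu$ consists of all holomorphic functions $f$ on $\mathbb{B}$ with $\|f\|=\sup_{z\in\mathbb{B}}\mu(|z|)|f(z)|<\infty$. *)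

theory Defs
  imports "HOL-Complex_Analysis.Complex_Analysis"
begin

text \<open>Holomorphy in several complex variables, for functions on an open subset of
  \<open>complex ^ 'n\<close>: complex Frechet differentiability, i.e. the (real) derivative exists at every
  point and is complex linear. Real linearity is part of \<open>has_derivative\<close>, so only
  compatibility with complex scalars has to be required.\<close>

definition holomorphic_vec_on :: "(complex ^ 'n \<Rightarrow> complex) \<Rightarrow> (complex ^ 'n) set \<Rightarrow> bool"
    (infixl "holomorphic'_vec'_on" 50) where
  "f holomorphic_vec_on S \<longleftrightarrow>
     (\<forall>z\<in>S. \<exists>D. (f has_derivative D) (at z) \<and> (\<forall>c v. D (c *s v) = c * D v))"

text \<open>Weights are total functions, but only their values on \<open>{0..<1}\<close> matter. ``Decreasing'' and
  ``increasing'' are read non-strictly; the strict reading gives the same class of weights, since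
  \<open>\<alpha>\<close> may be decreased and \<open>\<beta>\<close> increased.\<close>

definition normal_weight :: "(real \<Rightarrow> real) \<Rightarrow> bool" where
  "normal_weight \<mu> \<longleftrightarrow>
     continuous_on {0..<1} \<mu> \<and> (\<forall>r\<in>{0..<1}. \<mu> r > 0) \<and>
     (\<exists>\<alpha> \<beta> \<delta>. 0 < \<alpha> \<and> \<alpha> < \<beta> \<and> 0 < \<delta> \<and> \<delta> < 1 \<and>
        antimono_on {\<delta>..<1} (\<lambda>r. \<mu> r / (1 - r) powr \<alpha>) \<and>
        ((\<lambda>r. \<mu> r / (1 - r) powr \<alpha>) \<longlongrightarrow> 0) (at_left 1) \<and>
        mono_on {\<delta>..<1} (\<lambda>r. \<mu> r / (1 - r) powr \<beta>) \<and>
        filterlim (\<lambda>r. \<mu> r / (1 - r) powr \<beta>) at_top (at_left 1))"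

definition weighted_norm :: "(real \<Rightarrow> real) \<Rightarrow> (complex ^ 'n \<Rightarrow> complex) \<Rightarrow> ereal" where
  "weighted_norm \<mu> f = (SUP z\<in>ball 0 1. ereal (\<mu> (norm z) * norm (f z)))"

definition weighted_Hinf :: "(real \<Rightarrow> real) \<Rightarrow> (complex ^ 'n \<Rightarrow> complex) set" where
  "weighted_Hinf \<mu> = {f. f holomorphic_vec_on ball 0 1 \<and> weighted_norm \<mu> f < \<infinity>}"

end

theory Submission imports Defs begin

text \<open>In one variable, the lattice sum \<open>\<Sum>exp (a * z - a\<^sup>2 / 2)\<close> over \<open>a\<close> in \<open>4\<int>\<close> or \<open>4\<int> + 2\<close> has
  terms of modulus \<open>exp ((Re z)\<^sup>2 / 2) * exp (- (Re z - a)\<^sup>2 / 2)\<close>, so both sums are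
  \<open>O(exp ((Re z)\<^sup>2 / 2))\<close> and at every point one of them is of exactly that size. Multiplying such
  sums in \<open>sqrt N * z\<^sub>j\<close> and in \<open>- \<i> * sqrt N * z\<^sub>j\<close> over all coordinates gives, for every \<open>N > 0\<close>, a
  family of \<open>4 ^ n\<close> functions bounded by a constant times \<open>exp (- N * (1 - |z|\<^sup>2) / 2)\<close>, one of
  which attains that order at each point, with constants independent of \<open>N\<close>. These functions play
  the role of Ryll--Wojtaszczyk polynomials.

  The required functions are the lacunary series with coefficients \<open>1 / \<mu> (1 - 1 / N)\<close>, where \<open>N\<close>
  runs through every second term of a geometric progression of ratio \<open>Q\<close>. Normality of \<open>\<mu>\<close> makes the
  terms decay geometrically away from the scale \<open>N \<approx> 1 / (1 - |z|)\<close>. Of the two parity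
  classes of exponents, one contains the largest power \<open>N \<le> 1 / (1 - |z|)\<close>, whose term then dominates
  that series if \<open>Q\<close> is large. A constant function takes care of a compact subset of the ball.\<close>

no_notation fps_nth (infixl \<open>$\<close> 75)

section \<open>Geometric sums over finite sets of naturals and integers\<close>

lemma geometric_sum_le:
  fixes r :: real
  assumes "finite S" "0 \<le> r" "r < 1"
  shows "(\<Sum>n\<in>S. r ^ n) \<le> 1 / (1 - r)"
  using sum_le_suminf[of "\<lambda>n. r ^ n" S] suminf_geometric[of r] assms
  by (simp add: summable_geometric)

text \<open>Each side of \<open>l\<close> contributes at most \<open>r / (1 - r)\<close>. Leaving
  out \<open>l\<close> keeps the factor \<open>r\<close>, which later makes the off-peak terms
  small.\<close>

lemma geometric_sum_int_le:
  fixes r :: real and S :: "int set"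
  assumes S: "finite S" and r: "0 \<le> r" "r < 1" and l: "l \<notin> S"
  shows "(\<Sum>j\<in>S. r ^ nat \<bar>j - l\<bar>) \<le> 2 * r / (1 - r)"
proof -
  have half: "(\<Sum>j\<in>X. r ^ nat \<bar>j - l\<bar>) \<le> r / (1 - r)"
    if X: "finite X" "inj_on (\<lambda>j. nat \<bar>j - l\<bar> - 1) X" "l \<notin> X" for X :: "int set"
  proof -
    \<comment> \<open>As \<open>l\<close> is not in \<open>X\<close>, the exponent is at least 1 and
      one factor \<open>r\<close> splits off; the reduced exponents are distinct.\<close>
    have "nat \<bar>j - l\<bar> = Suc (nat \<bar>j - l\<bar> - 1)" if "j \<in> X" for j
      using that X(3) by (cases "j = l") auto
    then have "(\<Sum>j\<in>X. r ^ nat \<bar>j - l\<bar>) = (\<Sum>j\<in>X. r * r ^ (nat \<bar>j - l\<bar> - 1))"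
      by (intro sum.cong refl) (metis power_Suc)
    also have "\<dots> = r * (\<Sum>n\<in>(\<lambda>j. nat \<bar>j - l\<bar> - 1) ` X. r ^ n)"
      using X(2) by (simp add: sum.reindex sum_distrib_left)
    also have "\<dots> \<le> r * (1 / (1 - r))"
      using X(1) r by (intro mult_left_mono geometric_sum_le) auto
    finally show ?thesis by simp
  qed
  have "(\<Sum>j\<in>S. r ^ nat \<bar>j - l\<bar>)
      = (\<Sum>j\<in>{j\<in>S. l < j}. r ^ nat \<bar>j - l\<bar>) + (\<Sum>j\<in>{j\<in>S. j < l}. r ^ nat \<bar>j - l\<bar>)"
  proof -
    have "j < l \<or> l < j" if "j \<in> S" for j using that l by (cases "j = l") auto
    then have "S = {j\<in>S. l < j} \<union> {j\<in>S. j < l}" by auto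
    then have "(\<Sum>j\<in>S. r ^ nat \<bar>j - l\<bar>) = (\<Sum>j\<in>{j\<in>S. l < j} \<union> {j\<in>S. j < l}. r ^ nat \<bar>j - l\<bar>)"
      by (rule arg_cong)
    also have "\<dots> = (\<Sum>j\<in>{j\<in>S. l < j}. r ^ nat \<bar>j - l\<bar>) + (\<Sum>j\<in>{j\<in>S. j < l}. r ^ nat \<bar>j - l\<bar>)"
      using S by (intro sum.union_disjoint) auto
    finally show ?thesis .
  qed
  also have "\<dots> \<le> r / (1 - r) + r / (1 - r)"
    using S by (intro add_mono half) (auto simp: inj_on_def)
  finally show ?thesis by simp
qed

lemma geometric_sum_int_le':
  fixes r :: real and S :: "int set"
  assumes S: "finite S" and r: "0 \<le> r" "r < 1"
  shows "(\<Sum>j\<in>S. r ^ nat \<bar>j - l\<bar>) \<le> (1 + r) / (1 - r)"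
proof -
  have "(\<Sum>j\<in>S. r ^ nat \<bar>j - l\<bar>) \<le> (\<Sum>j\<in>insert l (S - {l}). r ^ nat \<bar>j - l\<bar>)"
    using S r by (intro sum_mono2) auto
  also have "\<dots> \<le> 1 + 2 * r / (1 - r)"
    using S r by (subst sum.insert) (auto intro!: geometric_sum_int_le)
  finally show ?thesis using r by (simp add: field_simps)
qed

subsection \<open>Lattice sums of exponentials\<close>

text \<open>Only finitely many lattice points matter on a bounded set; truncating at \<open>K\<close> makes
  holomorphy trivial, and the constants in the estimates do not depend on \<open>K\<close>.\<close>

definition theta :: "nat \<Rightarrow> bool \<Rightarrow> complex \<Rightarrow> complex" where
  "theta K s z = (\<Sum>m = - int K..int K. exp (complex_of_real (4 * of_int m + 2 * of_bool s) * z
       - (complex_of_real (4 * of_int m + 2 * of_bool s))\<^sup>2 / 2))"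

lemma norm_exp_complete_square:
  "norm (exp (complex_of_real a * z - (complex_of_real a)\<^sup>2 / 2))
     = exp ((Re z)\<^sup>2 / 2) * exp (- (Re z - a)\<^sup>2 / 2)"
  by (simp add: power2_eq_square field_simps flip: exp_add)

lemma of_int_zero_or_abs_ge_one:
  "of_int d = (0 :: 'a :: linordered_idom) \<or> 1 \<le> \<bar>of_int d :: 'a\<bar>"
proof (cases "d = 0")
  case False
  then have "1 \<le> \<bar>d\<bar>" by simp
  then show ?thesis by (metis of_int_abs of_int_1_le_iff)
qed simp

text \<open>An integer \<open>d\<close> satisfies \<open>d\<^sup>2 \<ge> \<bar>d\<bar>\<close>, so
  Gaussian decay along points of spacing at least \<open>b\<close> is dominated by geometric
  decay.\<close>

lemma exp_square_le_power:
  fixes t b q :: real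
  assumes "b * of_int \<bar>d\<bar> \<le> \<bar>t\<bar>" "0 \<le> b" "exp (- b\<^sup>2 / 2) \<le> q"
  shows "exp (- t\<^sup>2 / 2) \<le> q ^ nat \<bar>d\<bar>"
proof -
  have q: "0 \<le> q" using assms(3) by (smt (verit) exp_gt_zero)
  have "of_int \<bar>d\<bar> * b\<^sup>2 \<le> (b * of_int \<bar>d\<bar>)\<^sup>2"
  proof -
    have "(of_int \<bar>d\<bar> :: real) \<le> (of_int \<bar>d\<bar>)\<^sup>2"
      using of_int_zero_or_abs_ge_one[of d, where 'a = real] self_le_power[of "\<bar>of_int d :: real\<bar>" 2] by auto
    then show ?thesis using mult_left_mono[of "of_int \<bar>d\<bar>" "(of_int \<bar>d\<bar>)\<^sup>2 :: real" "b\<^sup>2"]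
      by (simp add: power_mult_distrib mult.commute)
  qed
  also have "\<dots> \<le> t\<^sup>2"
    using power_mono[OF assms(1), of 2] assms(2) by simp
  finally have "exp (- t\<^sup>2 / 2) \<le> exp (of_nat (nat \<bar>d\<bar>) * (- b\<^sup>2 / 2))"
    by simp
  also have "\<dots> = exp (- b\<^sup>2 / 2) ^ nat \<bar>d\<bar>"
    by (rule exp_of_nat_mult)
  also have "\<dots> \<le> q ^ nat \<bar>d\<bar>"
    using assms(3) by (intro power_mono) auto
  finally show ?thesis .
qed

text \<open>The first two parts are the ratios \<open>exp (- b\<^sup>2 / 2)\<close> for the spacings
  2 and 3 used below; the third is the height of the Gaussian at distance 1 from its centre.\<close>

lemma exp_neg_le: "exp (- 2 :: real) \<le> 1 / 2" "exp (- 9 / 2 :: real) \<le> 1 / 16"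
  "exp (- 1 / 2 :: real) \<ge> 1 / 2"
proof -
  have "exp (1 :: real) \<ge> 2" using exp_ge_add_one_self[of "1 :: real"] by simp
  then have "exp (1 :: real) ^ 4 \<ge> 2 ^ 4" by (intro power_mono) auto
  then have "exp (4 :: real) \<ge> 16" by (simp flip: exp_of_nat_mult)
  then have "exp (9 / 2 :: real) \<ge> 16" by (smt (verit) exp_le_cancel_iff field_sum_of_halves)
  then show "exp (- 9 / 2 :: real) \<le> 1 / 16" by (simp add: exp_minus field_simps)
  have "exp (2 :: real) \<ge> 2" using exp_ge_add_one_self[of "2 :: real"] by simp
  then show "exp (- 2 :: real) \<le> 1 / 2" by (simp add: exp_minus field_simps)
  show "exp (- 1 / 2 :: real) \<ge> 1 / 2" using exp_ge_add_one_self[of "- 1 / 2 :: real"] by simp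
qed

lemma norm_theta_le: "norm (theta K s z) \<le> 3 * exp ((Re z)\<^sup>2 / 2)"
proof -
  define a :: "int \<Rightarrow> real" where "a m = 4 * of_int m + 2 * of_bool s" for m
  \<comment> \<open>The nearest point of the coset; spacing 4 puts it within 2 of
    \<open>Re z\<close>. It may fall outside the truncation, which does no harm to an upper
    bound.\<close>
  define l where "l = round ((Re z - 2 * of_bool s) / 4)"
  have l: "\<bar>Re z - a l\<bar> \<le> 2"
    using of_int_round_abs_le[of "(Re z - 2 * of_bool s) / 4"] 
    unfolding a_def l_def[symmetric] abs_le_iff
    by (simp add: field_simps)
  have "norm (theta K s z) \<le> (\<Sum>m = - int K..int K. exp ((Re z)\<^sup>2 / 2) * exp (- (Re z - a m)\<^sup>2 / 2))"
    unfolding theta_def a_def norm_exp_complete_square[symmetric] by (rule norm_sum)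
  also have "\<dots> \<le> (\<Sum>m = - int K..int K. exp ((Re z)\<^sup>2 / 2) * (1 / 2) ^ nat \<bar>m - l\<bar>)"
  proof (intro sum_mono mult_left_mono exp_square_le_power[where b = 2])
    fix m
    \<comment> \<open>For \<open>m \<noteq> l\<close> the distance to \<open>Re z\<close> is at
      least 4|m - l| - 2, hence at least 2|m - l|.\<close>
    have "a m - a l = 4 * of_int (m - l)" by (simp add: a_def)
    moreover have "of_int (m - l) = (0 :: real) \<or> 1 \<le> \<bar>of_int (m - l) :: real\<bar>"
      by (rule of_int_zero_or_abs_ge_one)
    ultimately show "2 * real_of_int \<bar>m - l\<bar> \<le> \<bar>Re z - a m\<bar>"
      using l unfolding of_int_abs by (smt (verit, best))
  qed (use exp_neg_le in auto)
  also have "\<dots> = exp ((Re z)\<^sup>2 / 2) * (\<Sum>m = - int K..int K. (1 / 2) ^ nat \<bar>m - l\<bar>)"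
    by (simp add: sum_distrib_left)
  also have "\<dots> \<le> exp ((Re z)\<^sup>2 / 2) * ((1 + 1 / 2) / (1 - 1 / 2))"
    by (intro mult_left_mono geometric_sum_int_le') auto
  finally show ?thesis by (simp add: mult.commute)
qed

text \<open>The two cosets together form the even integers, so one of them has a point within 1 of
  \<open>Re z\<close>. Its term is at least 1/2 of the Gaussian size, and the rest of that coset
  adds up to at most 1/4.\<close>

lemma norm_theta_ge:
  assumes "\<bar>Re z\<bar> \<le> real K"
  shows "\<exists>s. norm (theta K s z) \<ge> exp ((Re z)\<^sup>2 / 2) / 4"
proof -
  \<comment> \<open>\<open>2 * p\<close> is the nearest even integer; the parity of \<open>p\<close>
    selects the coset and \<open>p div 2\<close> the index in it.\<close>
  define p where "p = round (Re z / 2)"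
  define s where "s = odd p"
  define l where "l = p div 2"
  define a :: "int \<Rightarrow> real" where "a m = 4 * of_int m + 2 * of_bool s" for m
  define e where "e m = exp (complex_of_real (a m) * z - (complex_of_real (a m))\<^sup>2 / 2)" for m
  have pl: "p = 2 * l + of_bool s" unfolding s_def l_def by (cases "even p") (auto elim!: evenE oddE)
  have al: "a l = 2 * of_int p" unfolding a_def pl by simp
  have l: "\<bar>Re z - a l\<bar> \<le> 1"
    using of_int_round_abs_le[of "Re z / 2"] unfolding al p_def[symmetric] by linarith
  \<comment> \<open>Since \<open>2 * p\<close> is within 1 of \<open>Re z\<close>, 2|p| is at most K
    + 1, so the truncated sum contains the peak term.\<close>
  have "\<bar>p\<bar> \<le> int K" "K = 0 \<longrightarrow> p = 0"
    using l assms unfolding al by linarith+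
  then have lK: "l \<in> {- int K..int K}" unfolding l_def by auto
  have "(\<Sum>m\<in>{- int K..int K} - {l}. norm (e m)) \<le>
      (\<Sum>m\<in>{- int K..int K} - {l}. exp ((Re z)\<^sup>2 / 2) * (1 / 16) ^ nat \<bar>m - l\<bar>)"
    unfolding e_def norm_exp_complete_square
  proof (intro sum_mono mult_left_mono exp_square_le_power[where b = 3])
    \<comment> \<open>Now |m - l| is at least 1, so the distance is at least 4|m - l| - 1, hence at
      least 3|m - l|.\<close>
    fix m assume "m \<in> {- int K..int K} - {l}"
    then have "1 \<le> \<bar>of_int (m - l) :: real\<bar>"
      using of_int_zero_or_abs_ge_one[of "m - l", where 'a = real] by auto
    moreover have "a m - a l = 4 * of_int (m - l)" by (simp add: a_def)
    ultimately show "3 * real_of_int \<bar>m - l\<bar> \<le> \<bar>Re z - a m\<bar>"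
      using l unfolding of_int_abs by (smt (verit, best))
  qed (use exp_neg_le in auto)
  also have "\<dots> = exp ((Re z)\<^sup>2 / 2) * (\<Sum>m\<in>{- int K..int K} - {l}. (1 / 16) ^ nat \<bar>m - l\<bar>)"
    by (simp add: sum_distrib_left)
  also have "\<dots> \<le> exp ((Re z)\<^sup>2 / 2) * (2 * (1 / 16) / (1 - 1 / 16))"
    by (intro mult_left_mono geometric_sum_int_le) auto
  also have "\<dots> \<le> exp ((Re z)\<^sup>2 / 2) * (1 / 4)"
    by (intro mult_left_mono) auto
  finally have rest: "norm (\<Sum>m\<in>{- int K..int K} - {l}. e m) \<le> exp ((Re z)\<^sup>2 / 2) / 4"
    
    using norm_sum[of e "{- int K..int K} - {l}"] by simp
  have "(Re z - a l)\<^sup>2 \<le> 1" using l by (simp add: abs_square_le_1)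
  then have "exp (- 1 / 2) \<le> exp (- (Re z - a l)\<^sup>2 / 2)" by simp
  then have "1 / 2 \<le> exp (- (Re z - a l)\<^sup>2 / 2)" using exp_neg_le(3) by linarith
  from mult_left_mono[OF this, of "exp ((Re z)\<^sup>2 / 2)"]
  have "norm (e l) \<ge> exp ((Re z)\<^sup>2 / 2) / 2"
    unfolding e_def norm_exp_complete_square by simp
  moreover have "theta K s z = e l + (\<Sum>m\<in>{- int K..int K} - {l}. e m)"
    unfolding theta_def e_def a_def using lK by (intro sum.remove) auto
  ultimately have "norm (theta K s z) \<ge> exp ((Re z)\<^sup>2 / 2) / 4"
    using rest norm_diff_ineq[of "e l" "\<Sum>m\<in>{- int K..int K} - {l}. e m"] by simp
  then show ?thesis by blast
qed

subsection \<open>Series of holomorphic functions of several variables\<close>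

lemma norm_vector_scalar_mult:
  fixes v :: "complex ^ 'n"
  shows "norm (c *s v) = norm c * norm v"
  by (simp add: norm_vec_def norm_mult L2_set_right_distrib)

lemma has_derivative_vec_nth: "((\<lambda>z. z $ j) has_derivative (\<lambda>h. h $ j)) F"
  by (rule bounded_linear_imp_has_derivative[OF bounded_linear_vec_nth])

lemma holomorphic_vec_on_const: "(\<lambda>z. c) holomorphic_vec_on S"
  unfolding holomorphic_vec_on_def by (auto intro!: exI[of _ "\<lambda>h. 0"])

lemma holomorphic_vec_on_mult:
  assumes "f holomorphic_vec_on S" "g holomorphic_vec_on S"
  shows "(\<lambda>z. f z * g z) holomorphic_vec_on S"
  unfolding holomorphic_vec_on_def
proof
  fix z assume "z \<in> S"
  then obtain D E where "(f has_derivative D) (at z)" "\<And>c v. D (c *s v) = c * D v"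
    "(g has_derivative E) (at z)" "\<And>c v. E (c *s v) = c * E v"
    using assms unfolding holomorphic_vec_on_def by metis
  then show "\<exists>D. ((\<lambda>z. f z * g z) has_derivative D) (at z) \<and> (\<forall>c v. D (c *s v) = c * D v)"
    by (intro exI[of _ "\<lambda>h. f z * E h + D h * g z"] conjI has_derivative_mult) (auto simp: algebra_simps)
qed

lemma holomorphic_vec_on_prod:
  assumes "\<And>j. j \<in> J \<Longrightarrow> f j holomorphic_vec_on S"
  shows "(\<lambda>z. \<Prod>j\<in>J. f j z) holomorphic_vec_on S"
  using assms
  by (induction J rule: infinite_finite_induct)
     (simp_all add: holomorphic_vec_on_const holomorphic_vec_on_mult)

lemma holomorphic_vec_on_compose_coordinate:
  fixes S :: "(complex ^ 'n) set"
  assumes "g holomorphic_on UNIV"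
  shows "(\<lambda>z. g (c * z $ j)) holomorphic_vec_on S"
  unfolding holomorphic_vec_on_def
proof
  fix z :: "complex ^ 'n"
  obtain g' where "(g has_field_derivative g') (at (c * z $ j))"
    using assms unfolding holomorphic_on_def field_differentiable_def by auto
  then have "(g has_derivative (\<lambda>t. g' * t)) (at (c * z $ j))"
    by (simp add: has_field_derivative_def)
  from has_derivative_compose[OF has_derivative_mult_right[OF has_derivative_vec_nth] this]
  show "\<exists>D. ((\<lambda>z. g (c * z $ j)) has_derivative D) (at z) \<and> (\<forall>b v. D (b *s v) = b * D v)"
    by (intro exI[of _ "\<lambda>h. g' * (c * h $ j)"]) auto
qed

text \<open>Complex linearity of \<open>D\<close> makes the restriction to a complex line
  holomorphic in one variable, which opens the way to Cauchy's inequality.\<close>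

lemma has_derivative_along_line:
  fixes f :: "complex ^ 'n \<Rightarrow> complex"
  assumes "(f has_derivative D) (at (w + t *s h))" "\<And>(c :: complex) v. D (c *s v) = c * D v"
  shows "((\<lambda>t :: complex. f (w + t *s h)) has_field_derivative D h) (at t)"
proof -
  have "bounded_linear (\<lambda>t :: complex. t *s h)"
    by (intro bounded_linear_intro[of _ "norm h"])
       (auto simp: vec_eq_iff scaleR_conv_of_real[where 'a = complex] algebra_simps norm_vector_scalar_mult)
  then have "((\<lambda>t. w + t *s h) has_derivative (\<lambda>t. t *s h)) (at t)"
    using has_derivative_add[OF has_derivative_const bounded_linear_imp_has_derivative] by fastforce
  from has_derivative_compose[OF this assms(1)]
  show ?thesis
    unfolding has_field_derivative_def by (simp add: assms(2) mult_commute_abs)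
qed

lemma Cauchy_inequality_vec:
  fixes f :: "complex ^ 'n \<Rightarrow> complex"
  assumes hol: "f holomorphic_vec_on ball w r" and bound: "\<And>v. v \<in> ball w r \<Longrightarrow> norm (f v) \<le> B"
    and D: "(f has_derivative D) (at w)" "\<And>c v. D (c *s v) = c * D v" and r: "0 < r"
  shows "norm (D h) \<le> 2 * B / r * norm h"
proof (cases "h = 0")
  case True
  then show ?thesis
    using D(2)[of 0 0] by simp
next
  case False
  \<comment> \<open>On the disc of radius \<open>q\<close> the point \<open>w + t *s h\<close> stays
    within \<open>r / 2\<close> of \<open>w\<close>; this half is the source of the factor
    2.\<close>
  define q where "q = r / (2 * norm h)"
  define \<phi> where "\<phi> t = f (w + t *s h)" for t :: complex
  have q: "0 < q" using False r by (simp add: q_def)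
  have in_ball: "w + t *s h \<in> ball w r" if "t \<in> cball 0 q" for t :: complex
  proof -
    have "norm t * norm h \<le> q * norm h" using that by (intro mult_right_mono) auto
    then show ?thesis using False r by (simp add: dist_norm norm_vector_scalar_mult q_def)
  qed
  have "\<phi> holomorphic_on cball 0 q"
    unfolding holomorphic_on_def field_differentiable_def \<phi>_def
  proof
    fix t :: complex assume "t \<in> cball 0 q"
    then obtain E where "(f has_derivative E) (at (w + t *s h))" "\<And>c v. E (c *s v) = c * E v"
      using hol in_ball unfolding holomorphic_vec_on_def by metis
    from has_derivative_along_line[OF this]
    show "\<exists>f'. ((\<lambda>t. f (w + t *s h)) has_field_derivative f') (at t within cball 0 q)"
      by (auto intro: has_field_derivative_at_within)
  qed
  then have "\<phi> holomorphic_on ball 0 q" "continuous_on (cball 0 q) \<phi>"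
    by (auto intro: holomorphic_on_subset holomorphic_on_imp_continuous_on)
  then have "norm ((deriv ^^ 1) \<phi> 0) \<le> fact 1 * B / q ^ 1"
    using q in_ball bound by (intro Cauchy_inequality) (auto simp: \<phi>_def)
  moreover have "deriv \<phi> 0 = D h"
    unfolding \<phi>_def by (intro DERIV_imp_deriv has_derivative_along_line) (use D in auto)
  ultimately show ?thesis using False by (simp add: q_def field_simps)
qed

lemma norm_suminf_tail_le:
  fixes u :: "nat \<Rightarrow> 'a :: banach"
  assumes b: "summable b" and u: "\<And>k. norm (u k) \<le> b k"
  shows "norm ((\<Sum>k<n. u k) - (\<Sum>k. u k)) \<le> (\<Sum>k. b (k + n))"
proof -
  have "summable u" using b u by (rule summable_comparison_test')
  then have "(\<Sum>k. u k) = (\<Sum>k. u (k + n)) + (\<Sum>k<n. u k)" by (rule suminf_split_initial_segment)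
  moreover have "norm (\<Sum>k. u (k + n)) \<le> (\<Sum>k. b (k + n))"
    using u summable_ignore_initial_segment[OF b] by (rule norm_suminf_le)
  ultimately show ?thesis by (simp add: norm_minus_commute)
qed

text \<open>A Weierstrass theorem: local domination of the terms passes to their derivatives by
  Cauchy's inequality, so the series may be differentiated term by term.\<close>

lemma holomorphic_vec_on_suminf:
  fixes f :: "nat \<Rightarrow> complex ^ 'n \<Rightarrow> complex"
  assumes hol: "\<And>k. f k holomorphic_vec_on S"
    and dom: "\<And>z. z \<in> S \<Longrightarrow> \<exists>r b. 0 < r \<and> ball z r \<subseteq> S \<and> summable b \<and> (\<forall>k. \<forall>w\<in>ball z r. norm (f k w) \<le> b k)"
  shows "(\<lambda>z. \<Sum>k. f k z) holomorphic_vec_on S"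
  unfolding holomorphic_vec_on_def
proof
  fix z assume z: "z \<in> S"
  obtain r b where r: "0 < r" "ball z r \<subseteq> S" and b: "summable b"
    and fb: "\<And>k w. w \<in> ball z r \<Longrightarrow> norm (f k w) \<le> b k"
    using dom[OF z] by blast
  \<comment> \<open>Half the radius leaves each point of \<open>U\<close> a ball of radius
    \<open>r / 2\<close> on which the bounds \<open>b k\<close> still hold.\<close>
  define U where "U = ball z (r / 2)"
  have U: "ball w (r / 2) \<subseteq> ball z r" if "w \<in> U" for w

  proof
    fix v assume "v \<in> ball w (r / 2)"
    then show "v \<in> ball z r" using that dist_triangle[of z v w] by (simp add: U_def)
  qed
  obtain D where D: "\<And>k w. w \<in> S \<Longrightarrow> (f k has_derivative D k w) (at w)"
      "\<And>k w c v. w \<in> S \<Longrightarrow> D k w (c *s v) = c * D k w v"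
    using hol unfolding holomorphic_vec_on_def by metis
  have US: "U \<subseteq> S" using r unfolding U_def by (auto intro: subset_trans[OF subset_ball])
  have Db: "norm (D k w h) \<le> b k * (4 / r * norm h)" if "w \<in> U" for k w h
  proof -
    have "norm (D k w h) \<le> 2 * b k / (r / 2) * norm h"
    proof (rule Cauchy_inequality_vec)
      show "f k holomorphic_vec_on ball w (r / 2)"
        using hol U[OF that] r unfolding holomorphic_vec_on_def by blast
    qed (use U[OF that] US that fb D r in auto)
    then show ?thesis by (simp add: mult_ac)
  qed
  define E where "E w h = (\<Sum>k. D k w h)" for w h
  have "\<exists>g. \<forall>w\<in>U. (\<lambda>k. f k w) sums g w \<and> (g has_derivative E w) (at w within U)"
  proof (rule has_derivative_series)
    show "convex U" by (simp add: U_def)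
    show "(f k has_derivative D k w) (at w within U)" if "w \<in> U" for k w
      using D that US by (blast intro: has_derivative_at_withinI)
    show "z \<in> U" using r by (simp add: U_def)
    show "(\<lambda>k. f k z) sums (\<Sum>k. f k z)"
      using b fb[of z] r by (intro summable_sums summable_comparison_test'[OF b]) auto
    fix e :: real assume e: "0 < e"
    \<comment> \<open>The tails of \<open>b\<close> control the tails of the derivative series
      uniformly in \<open>w\<close>, with \<open>norm h\<close> as a factor.\<close>
    have "(\<lambda>n. (\<Sum>k. b (k + n)) * (4 / r)) \<longlonglongrightarrow> 0 * (4 / r)"
      by (intro tendsto_mult tendsto_const suminf_exist_split2 b)
    then have "\<forall>\<^sub>F n in sequentially. (\<Sum>k. b (k + n)) * (4 / r) < e"
      using e by (intro order_tendstoD) auto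
    then show "\<forall>\<^sub>F n in sequentially. \<forall>w\<in>U. \<forall>h. norm ((\<Sum>k<n. D k w h) - E w h) \<le> e * norm h"
    proof eventually_elim
      case (elim n)
      show ?case
      proof (intro ballI allI)
        fix w h assume w: "w \<in> U"
        have "norm ((\<Sum>k<n. D k w h) - E w h) \<le> (\<Sum>k. b (k + n) * (4 / r * norm h))"
          unfolding E_def using Db[OF w] by (intro norm_suminf_tail_le summable_mult2 b)
        also have "\<dots> = (\<Sum>k. b (k + n)) * (4 / r) * norm h"
          by (subst suminf_mult2[symmetric]) (auto intro!: summable_ignore_initial_segment b)
        also have "\<dots> \<le> e * norm h" using elim by (intro mult_right_mono) auto
        finally show "norm ((\<Sum>k<n. D k w h) - E w h) \<le> e * norm h" .
      qed
    qed
  qed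
  then obtain g where g: "\<And>w. w \<in> U \<Longrightarrow> (\<lambda>k. f k w) sums g w"
    "\<And>w. w \<in> U \<Longrightarrow> (g has_derivative E w) (at w within U)" by blast
  have zU: "z \<in> U" "open U" using r by (auto simp: U_def)
  have "((\<lambda>z. \<Sum>k. f k z) has_derivative E z) (at z)"
    using has_derivative_transform_within_open[of g "E z" z UNIV U "\<lambda>z. \<Sum>k. f k z"]
      g zU at_within_open[of z U] by (metis sums_unique)
  moreover have "E z (c *s v) = c * E z v" for c v
  proof -
    have "summable (\<lambda>k. D k z v)"
      using summable_mult2[OF b] Db[OF zU(1)] by (rule summable_comparison_test')
    then show ?thesis using D(2)[OF z] by (simp add: E_def suminf_mult)
  qed
  ultimately show "\<exists>D. ((\<lambda>z. \<Sum>k. f k z) has_derivative D) (at z) \<and> (\<forall>c v. D (c *s v) = c * D v)"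
    by blast
qed

subsection \<open>Building blocks on the ball\<close>

text \<open>The components of \<open>\<sigma> j\<close> pick the cosets for the real and the
  imaginary part of coordinate \<open>j\<close>, because Re (- \<i> w) = Im w. The truncation
  suffices on the ball, where \<open>sqrt N * z $ j\<close> has modulus at most
  \<open>sqrt N\<close>.\<close>

definition spike :: "real \<Rightarrow> ('n \<Rightarrow> bool \<times> bool) \<Rightarrow> complex ^ 'n \<Rightarrow> complex" where
  "spike N \<sigma> z = exp (- of_real N / 2) *
     (\<Prod>j\<in>UNIV. theta (nat \<lceil>sqrt N\<rceil>) (fst (\<sigma> j)) (sqrt N * z $ j) *
                theta (nat \<lceil>sqrt N\<rceil>) (snd (\<sigma> j)) (- \<i> * sqrt N * z $ j))"

lemma holomorphic_theta: "theta K s holomorphic_on UNIV"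
  unfolding theta_def[abs_def] by (intro holomorphic_intros)

lemma holomorphic_spike: "spike N \<sigma> holomorphic_vec_on S"
  unfolding spike_def[abs_def]
  by (intro holomorphic_vec_on_mult holomorphic_vec_on_const holomorphic_vec_on_prod
      holomorphic_vec_on_compose_coordinate holomorphic_theta)

lemma prod_exp_coordinates:
  fixes z :: "complex ^ 'n"
  assumes "0 \<le> N"
  shows "(\<Prod>j\<in>UNIV. exp ((Re (sqrt N * z $ j))\<^sup>2 / 2) * exp ((Re (- \<i> * sqrt N * z $ j))\<^sup>2 / 2))
    = exp (N * (norm z)\<^sup>2 / 2)"
proof -
  have "exp ((Re (sqrt N * z $ j))\<^sup>2 / 2) * exp ((Re (- \<i> * sqrt N * z $ j))\<^sup>2 / 2)
      = exp (N / 2 * (norm (z $ j))\<^sup>2)" for j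
    using assms by (simp add: cmod_power2 power_mult_distrib field_simps flip: exp_add)
  then have "(\<Prod>j\<in>UNIV. exp ((Re (sqrt N * z $ j))\<^sup>2 / 2) * exp ((Re (- \<i> * sqrt N * z $ j))\<^sup>2 / 2))
      = exp (N / 2 * (\<Sum>j\<in>UNIV. (norm (z $ j))\<^sup>2))"
    by (simp add: exp_sum sum_distrib_left)
  also have "(\<Sum>j\<in>UNIV. (norm (z $ j))\<^sup>2) = (norm z)\<^sup>2"
    by (simp add: norm_vec_def L2_set_def sum_nonneg)
  finally show ?thesis by simp
qed

lemma norm_spike:
  "norm (spike N \<sigma> z) = exp (- N / 2) *
     (\<Prod>j\<in>UNIV. norm (theta (nat \<lceil>sqrt N\<rceil>) (fst (\<sigma> j)) (sqrt N * z $ j)) *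
                norm (theta (nat \<lceil>sqrt N\<rceil>) (snd (\<sigma> j)) (- \<i> * sqrt N * z $ j)))"
  unfolding spike_def norm_mult prod_norm[symmetric] norm_exp_eq_Re by simp

lemma norm_spike_le:
  fixes z :: "complex ^ 'n"
  assumes "0 \<le> N"
  shows "norm (spike N \<sigma> z) \<le> 9 ^ CARD('n) * exp (- N * (1 - (norm z)\<^sup>2) / 2)"
proof -
  have "norm (spike N \<sigma> z) \<le> exp (- N / 2) *
    (\<Prod>j\<in>UNIV. 9 * (exp ((Re (sqrt N * z $ j))\<^sup>2 / 2) * exp ((Re (- \<i> * sqrt N * z $ j))\<^sup>2 / 2)))"
    unfolding norm_spike
  proof (intro mult_left_mono prod_mono conjI)
    fix j :: 'n
    show "norm (theta (nat \<lceil>sqrt N\<rceil>) (fst (\<sigma> j)) (sqrt N * z $ j)) *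
        norm (theta (nat \<lceil>sqrt N\<rceil>) (snd (\<sigma> j)) (- \<i> * sqrt N * z $ j))
      \<le> 9 * (exp ((Re (sqrt N * z $ j))\<^sup>2 / 2) * exp ((Re (- \<i> * sqrt N * z $ j))\<^sup>2 / 2))"
      by (rule order_trans[OF mult_mono[OF norm_theta_le norm_theta_le]]) auto
  qed (auto intro: prod_nonneg)
  also have "\<dots> = 9 ^ CARD('n) * (exp (- N / 2) * exp (N * (norm z)\<^sup>2 / 2))"
    
    unfolding prod.distrib[of "\<lambda>_. 9"] prod_constant prod_exp_coordinates[OF assms] by simp
  finally show ?thesis by (simp add: field_simps flip: exp_add)
qed

text \<open>The cosets are chosen separately for each real coordinate, so \<open>\<sigma>\<close>
  depends on \<open>z\<close>; each complex coordinate costs a factor 1/16 = 1/4 * 1/4.\<close>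

lemma norm_spike_ge:
  fixes z :: "complex ^ 'n"
  assumes N: "0 \<le> N" and z: "norm z < 1"
  shows "\<exists>\<sigma>. norm (spike N \<sigma> z) \<ge> (1 / 16) ^ CARD('n) * exp (- N * (1 - (norm z)\<^sup>2) / 2)"
proof -
  define K where "K = nat \<lceil>sqrt N\<rceil>"
  have K: "sqrt N \<le> real K" unfolding K_def by linarith
  have Re_le: "\<bar>Re w\<bar> \<le> real K" if "norm w \<le> sqrt N" for w :: complex
    using abs_Re_le_cmod[of w] that K by linarith
  have zj: "sqrt N * norm (z $ j) \<le> sqrt N" for j
    using N z Finite_Cartesian_Product.norm_nth_le[of z j]
    by (intro mult_right_le_one_le) auto
  have "\<exists>s. exp ((Re (sqrt N * z $ j))\<^sup>2 / 2) / 4 \<le> norm (theta K s (sqrt N * z $ j))" for j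
    using zj N by (intro norm_theta_ge Re_le) (simp add: norm_mult)
  then obtain s where s: "\<And>j. exp ((Re (sqrt N * z $ j))\<^sup>2 / 2) / 4 \<le> norm (theta K (s j) (sqrt N * z $ j))"
    by metis
  have "\<exists>t. exp ((Re (- \<i> * sqrt N * z $ j))\<^sup>2 / 2) / 4 \<le> norm (theta K t (- \<i> * sqrt N * z $ j))" for j
    using zj N by (intro norm_theta_ge Re_le) (simp add: norm_mult)
  then obtain t where t: "\<And>j. exp ((Re (- \<i> * sqrt N * z $ j))\<^sup>2 / 2) / 4 \<le> norm (theta K (t j) (- \<i> * sqrt N * z $ j))"
    by metis
  have "(1 / 16) ^ CARD('n) * exp (- N * (1 - (norm z)\<^sup>2) / 2)
      = exp (- N / 2) * ((1 / 16) ^ CARD('n) * exp (N * (norm z)\<^sup>2 / 2))"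
    by (simp add: field_simps flip: exp_add)
  also have "\<dots> = exp (- N / 2) *
    (\<Prod>j\<in>UNIV. 1 / 16 * (exp ((Re (sqrt N * z $ j))\<^sup>2 / 2) * exp ((Re (- \<i> * sqrt N * z $ j))\<^sup>2 / 2)))"
    by (simp only: prod.distrib[of "\<lambda>_. 1 / 16"] prod_constant prod_exp_coordinates[OF N])
  also have "\<dots> \<le> norm (spike N (\<lambda>j. (s j, t j)) z)"
    unfolding norm_spike K_def[symmetric] fst_conv snd_conv
  proof (intro mult_left_mono prod_mono conjI)
    fix j :: 'n
    show "1 / 16 * (exp ((Re (sqrt N * z $ j))\<^sup>2 / 2) * exp ((Re (- \<i> * sqrt N * z $ j))\<^sup>2 / 2))
      \<le> norm (theta K (s j) (sqrt N * z $ j)) * norm (theta K (t j) (- \<i> * sqrt N * z $ j))"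
      using mult_mono[OF s[of j] t[of j]] by simp
  qed (auto intro: prod_nonneg)
  finally show ?thesis by blast
qed

subsection \<open>Lacunary series\<close>

lemma power_divide_fact_le_exp:
  fixes x :: real
  assumes "0 \<le> x"
  shows "x ^ n / fact n \<le> exp x"
proof -
  have "(\<Sum>m\<in>{n}. x ^ m /\<^sub>R fact m) \<le> (\<Sum>m. x ^ m /\<^sub>R fact m)"
    using assms by (intro sum_le_suminf summable_exp_generic) auto
  then have "x ^ n /\<^sub>R fact n \<le> exp x" unfolding exp_def by simp
  then show ?thesis by (simp only: divide_inverse real_scaleR_def mult.commute)
qed

text \<open>One term of the exponential series beats the power. The square root fits the later use:
  with \<open>y = Q ^ (j - l)\<close>, the quotient \<open>L j / T\<close> is only known to be at
  least \<open>sqrt y\<close>.\<close>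

lemma powr_times_exp_sqrt_bounded:
  "\<exists>B\<ge>1. \<forall>y\<ge>1. y powr \<gamma> * exp (- sqrt y / 2) \<le> (B :: real)"
proof -
  obtain n :: nat where n: "2 * \<gamma> \<le> real n" using real_arch_simple by blast
  have "y powr \<gamma> * exp (- sqrt y / 2) \<le> fact n * 2 ^ n" if y: "1 \<le> y" for y :: real
  proof -
    have "y powr \<gamma> \<le> y powr (real n / 2)" using n y by (intro powr_mono) auto
    also have "\<dots> = (y powr (1 / 2)) powr real n" by (simp add: powr_powr)
    also have "\<dots> = sqrt y ^ n" using y by (simp add: powr_half_sqrt powr_realpow)
    also have "\<dots> = fact n * 2 ^ n * ((sqrt y / 2) ^ n / fact n)" by (simp add: power_divide)
    also have "\<dots> \<le> fact n * 2 ^ n * exp (sqrt y / 2)"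
      using y by (intro mult_left_mono power_divide_fact_le_exp) auto
    finally show ?thesis by (simp add: exp_minus field_simps)
  qed
  then have "y powr \<gamma> * exp (- sqrt y / 2) \<le> max 1 (fact n * 2 ^ n)" if "1 \<le> y" for y :: real
    using that by (simp add: le_max_iff_disj)
  then show ?thesis by (intro exI[of _ "max 1 (fact n * 2 ^ n)"]) auto
qed

text \<open>The reverse triangle inequality holds for every partial sum containing index
  \<open>k\<close> and passes to the limit.\<close>

lemma norm_suminf_ge:
  fixes u :: "nat \<Rightarrow> 'a :: banach"
  assumes u: "summable u" and rest: "\<And>G. finite G \<Longrightarrow> k \<notin> G \<Longrightarrow> (\<Sum>i\<in>G. norm (u i)) \<le> s"
  shows "norm (u k) - s \<le> norm (\<Sum>i. u i)"
proof (rule LIMSEQ_le_const)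
  show "(\<lambda>n. norm (\<Sum>i<n. u i)) \<longlonglongrightarrow> norm (\<Sum>i. u i)"
    by (intro tendsto_norm summable_LIMSEQ u)
  show "\<exists>N. \<forall>n\<ge>N. norm (u k) - s \<le> norm (\<Sum>i<n. u i)"
  proof (intro exI allI impI)
    fix n assume "Suc k \<le> n"
    then have "(\<Sum>i<n. u i) = u k + (\<Sum>i\<in>{..<n} - {k}. u i)"
      by (intro sum.remove) auto
    then show "norm (u k) - s \<le> norm (\<Sum>i<n. u i)"
      using norm_diff_ineq[of "u k" "\<Sum>i\<in>{..<n} - {k}. u i"] rest[of "{..<n} - {k}"]
        norm_sum[of u "{..<n} - {k}"] by simp
  qed
qed

lemma ex_power_interval:
  fixes x q :: real
  assumes "1 \<le> x" "1 < q"
  shows "\<exists>l. q ^ l \<le> x \<and> x < q ^ Suc l"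
proof -
  obtain n where "x < q ^ n" using real_arch_pow assms(2) by blast
  then have L: "x < q ^ (LEAST n. x < q ^ n)" by (rule LeastI)
  then obtain l where l: "(LEAST n. x < q ^ n) = Suc l"
    using assms(1) by (cases "LEAST n. x < q ^ n") auto
  then have "\<not> x < q ^ l" using not_less_Least[of l "\<lambda>n. x < q ^ n"] by auto
  then show ?thesis using L l by (auto simp: not_less)
qed

text \<open>The intended instance is \<open>a x = 1 / \<mu> (1 - 1 / x)\<close>.\<close>

locale lacunary_growth =
  fixes a :: "real \<Rightarrow> real" and \<alpha> \<beta> N0 B Q :: real
  assumes N0: "0 < N0" and exponents: "0 < \<alpha>" "0 < \<beta>"
    and pos: "\<And>x. N0 \<le> x \<Longrightarrow> 0 < a x"
    and growth_ge: "\<And>x y. N0 \<le> x \<Longrightarrow> x \<le> y \<Longrightarrow> a x \<le> a y * (x / y) powr \<alpha>"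
    and growth_le: "\<And>x y. N0 \<le> x \<Longrightarrow> x \<le> y \<Longrightarrow> a y \<le> a x * (y / x) powr \<beta>"
    and B: "1 \<le> B" "\<And>y. 1 \<le> y \<Longrightarrow> y powr (\<alpha> + \<beta>) * exp (- sqrt y / 2) \<le> B"
    and Q: "1 < Q" "Q powr - \<alpha> \<le> 1 / 2"
begin

section \<open>Decay of the terms away from the dominant scale\<close>

definition L :: "nat \<Rightarrow> real" where "L j = N0 * Q ^ j"

lemma L_ge: "N0 \<le> L j" using N0 Q one_le_power[of Q j] by (simp add: L_def)
lemma L_pos: "0 < L j" using L_ge[of j] N0 by linarith
lemma L_mono: "i \<le> j \<Longrightarrow> L i \<le> L j" using N0 Q by (simp add: L_def power_increasing)
lemma L_divide: "i \<le> j \<Longrightarrow> L j / L i = Q ^ (j - i)" using N0 Q by (simp add: L_def power_diff)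

lemma a_mono:
  assumes "N0 \<le> x" "x \<le> y"
  shows "a x \<le> a y"
proof -
  have "(x / y) powr \<alpha> \<le> 1" using assms N0 exponents by (intro powr_le1) auto
  then show ?thesis using growth_ge[OF assms] pos[of y] assms
    by (smt (verit) mult_left_le)
qed

lemma powr_power_swap: "(Q ^ d) powr x = (Q powr x) ^ d"
  using Q by (simp add: powr_powr powr_realpow[symmetric] mult.commute)

text \<open>The index \<open>Suc l\<close> is excluded because \<open>L (Suc l) / T\<close> may be close to 1, and then the
  exponential does not compensate the growth of \<open>a\<close>. This is why the series below use indices of
  one parity only.\<close>

lemma term_le:
  assumes T: "L l \<le> T" "T \<le> L (Suc l)" and j: "j \<noteq> Suc l"
  shows "a (L j) * exp (- L j / T / 2) \<le> B * a (L l) * (Q powr - \<alpha>) ^ nat \<bar>int j - int l\<bar>"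
proof -
  have Tpos: "0 < T" using T L_pos[of l] by linarith
  have al: "0 < a (L l)" by (intro pos L_ge)
  show ?thesis
  proof (cases "j \<le> l")
    case True
    \<comment> \<open>At lower frequencies the growth of \<open>a\<close> alone gives the decay, and
      the exponential is dropped.\<close>
    have "a (L j) * exp (- L j / T / 2) \<le> a (L j)"
      using pos[OF L_ge, of j] L_pos[of j] Tpos by (intro mult_left_le) auto
    also have "\<dots> \<le> a (L l) * (L j / L l) powr \<alpha>" using True by (intro growth_ge L_ge L_mono)
    also have "L j / L l = inverse (Q ^ (l - j))" using L_divide[OF True] by (metis inverse_divide)
    also have "\<dots> powr \<alpha> = (Q powr - \<alpha>) ^ (l - j)"
      using Q by (simp add: powr_minus inverse_powr powr_power_swap power_inverse)
    also have "a (L l) * (Q powr - \<alpha>) ^ (l - j) \<le> B * (a (L l) * (Q powr - \<alpha>) ^ (l - j))"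
      using mult_right_mono[OF B(1), of "a (L l) * (Q powr - \<alpha>) ^ (l - j)"] al by simp
    also have "l - j = nat \<bar>int j - int l\<bar>" using True by simp
    finally show ?thesis by (simp add: mult_ac)
  next
    case False
    define y where "y = Q ^ (j - l)"
    have y: "1 \<le> y" using Q by (simp add: y_def)
    \<comment> \<open>Here \<open>j \<ge> l + 2\<close>, so
      \<open>j - l \<le> 2 * (j - Suc l)\<close>: this is where the excluded index matters.\<close>
    have "sqrt y \<le> sqrt ((Q ^ (j - Suc l))\<^sup>2)"
      unfolding y_def power_mult[symmetric] using Q j False
      by (intro real_sqrt_le_mono power_increasing) auto
    also have "\<dots> = L j / L (Suc l)" using Q False j by (simp add: L_divide)
    also have "\<dots> \<le> L j / T" using T Tpos L_pos[of j] by (intro divide_left_mono) auto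
    finally have "exp (- L j / T / 2) \<le> exp (- sqrt y / 2)" by simp
    moreover have "a (L j) \<le> a (L l) * y powr \<beta>"
      unfolding y_def using False L_divide[of l j] growth_le[OF L_ge L_mono, of l j] by simp
    ultimately have "a (L j) * exp (- L j / T / 2) \<le> a (L l) * y powr \<beta> * exp (- sqrt y / 2)"
      using al by (intro mult_mono) auto
    \<comment> \<open>Splitting y^\<beta> as y^(\<alpha> + \<beta>) times y^(-\<alpha>) lets the
      exponential absorb the first factor; the second is the decay.\<close>
    also have "\<dots> = a (L l) * (y powr (\<alpha> + \<beta>) * exp (- sqrt y / 2)) * y powr - \<alpha>"
      using y by (simp add: powr_add powr_minus)
    also have "\<dots> \<le> a (L l) * B * y powr - \<alpha>"
      using al B(2)[OF y] by (intro mult_left_mono mult_right_mono) auto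
    also have "y powr - \<alpha> = (Q powr - \<alpha>) ^ nat \<bar>int j - int l\<bar>"
      unfolding y_def powr_power_swap using False by (simp add: nat_diff_distrib)
    finally show ?thesis by (simp add: mult_ac)
  qed
qed

text \<open>At \<open>Suc l\<close> the growth is at most Q^\<beta>, which is Q^(\<alpha> + \<beta>)
  times one decay factor; the larger constant therefore admits every index.\<close>

lemma term_le':
  assumes T: "L l \<le> T" "T \<le> L (Suc l)"
  shows "a (L j) * exp (- L j / T / 2)
    \<le> B * Q powr (\<alpha> + \<beta>) * a (L l) * (Q powr - \<alpha>) ^ nat \<bar>int j - int l\<bar>"
proof (cases "j = Suc l")
  case True
  have Tpos: "0 < T" using T L_pos[of l] by linarith
  have al: "0 < a (L l)" by (intro pos L_ge)
  have nonneg: "0 \<le> Q powr (\<alpha> + \<beta>) * a (L l) * Q powr - \<alpha>" using al by simp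
  have "a (L j) * exp (- L j / T / 2) \<le> a (L j)"
    using pos[OF L_ge, of j] L_pos[of j] Tpos by (intro mult_left_le) auto
  also have "\<dots> \<le> a (L l) * (Q ^ 1) powr \<beta>"
    using growth_le[OF L_ge L_mono, of l j] L_divide[of l j] True by simp
  also have "\<dots> = Q powr (\<alpha> + \<beta>) * a (L l) * Q powr - \<alpha>"
    using Q by (simp add: powr_add powr_minus)
  also have "\<dots> \<le> B * (Q powr (\<alpha> + \<beta>) * a (L l) * Q powr - \<alpha>)"
    using mult_right_mono[OF B(1) nonneg] by simp
  finally show ?thesis using True by (simp add: mult_ac)
next
  case False
  have "1 \<le> Q powr (\<alpha> + \<beta>)" using Q exponents by (intro ge_one_powr_ge_zero) auto
  then have "B * a (L l) * (Q powr - \<alpha>) ^ nat \<bar>int j - int l\<bar>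
      \<le> Q powr (\<alpha> + \<beta>) * (B * a (L l) * (Q powr - \<alpha>) ^ nat \<bar>int j - int l\<bar>)"
    using B(1) pos[OF L_ge, of l]
      mult_right_mono[of 1 "Q powr (\<alpha> + \<beta>)" "B * a (L l) * (Q powr - \<alpha>) ^ nat \<bar>int j - int l\<bar>"] by simp
  with term_le[OF T False] show ?thesis by (simp add: mult_ac)
qed

text \<open>The factor \<open>Q powr - \<alpha>\<close> is the gain from excluding \<open>l\<close>
  and \<open>Suc l\<close>: a large \<open>Q\<close> makes this remainder small against the term at
  \<open>l\<close>. The map \<open>g\<close> will be \<open>k \<mapsto> 2 * k + p\<close>.\<close>

lemma sum_terms_le:
  fixes g :: "nat \<Rightarrow> nat"
  assumes T: "L l \<le> T" "T \<le> L (Suc l)" and G: "finite G" "inj_on g G"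
    and away: "\<And>k. k \<in> G \<Longrightarrow> g k \<noteq> l \<and> g k \<noteq> Suc l"
  shows "(\<Sum>k\<in>G. a (L (g k)) * exp (- L (g k) / T / 2)) \<le> 4 * B * Q powr - \<alpha> * a (L l)"
proof -
  let ?r = "Q powr - \<alpha>"
  have inj: "inj_on (\<lambda>k. int (g k)) G" using G(2) by (auto simp: inj_on_def)
  have "(\<Sum>k\<in>G. a (L (g k)) * exp (- L (g k) / T / 2))
      \<le> (\<Sum>k\<in>G. B * a (L l) * ?r ^ nat \<bar>int (g k) - int l\<bar>)"
    using away by (intro sum_mono term_le[OF T]) auto
  also have "\<dots> = B * a (L l) * (\<Sum>j\<in>(\<lambda>k. int (g k)) ` G. ?r ^ nat \<bar>j - int l\<bar>)"
    by (simp add: sum.reindex[OF inj] sum_distrib_left)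
  also have "\<dots> \<le> B * a (L l) * (2 * ?r / (1 - ?r))"
    using B(1) pos[OF L_ge, of l] away Q G
    by (intro mult_left_mono geometric_sum_int_le) (auto dest: away)
  also have "\<dots> \<le> B * a (L l) * (4 * ?r)"
  proof (intro mult_left_mono)
    have "?r * (2 * ?r) \<le> ?r * 1" using Q by (intro mult_left_mono) auto
    then show "2 * ?r / (1 - ?r) \<le> 4 * ?r" using Q by (simp add: divide_le_eq algebra_simps)
  qed (use B(1) pos[OF L_ge, of l] in auto)
  finally show ?thesis by (simp add: mult_ac)
qed

lemma ex_scale:
  assumes "N0 \<le> T"
  shows "\<exists>l. L l \<le> T \<and> T \<le> L (Suc l)"
  using ex_power_interval[of "T / N0" Q] N0 Q assms by (auto simp: L_def field_simps intro: less_imp_le)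

lemma sum_terms_le':
  fixes g :: "nat \<Rightarrow> nat"
  assumes T: "N0 \<le> T" and G: "finite G" "inj_on g G"
  shows "(\<Sum>k\<in>G. a (L (g k)) * exp (- L (g k) / T / 2)) \<le> 3 * B * Q powr (\<alpha> + \<beta>) * a T"
proof -
  let ?r = "Q powr - \<alpha>" and ?B = "B * Q powr (\<alpha> + \<beta>)"
  obtain l where l: "L l \<le> T" "T \<le> L (Suc l)" using ex_scale[OF T] by blast
  have inj: "inj_on (\<lambda>k. int (g k)) G" using G(2) by (auto simp: inj_on_def)
  have "(\<Sum>k\<in>G. a (L (g k)) * exp (- L (g k) / T / 2))
      \<le> (\<Sum>k\<in>G. ?B * a (L l) * ?r ^ nat \<bar>int (g k) - int l\<bar>)"
    by (intro sum_mono term_le'[OF l])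
  also have "\<dots> = ?B * a (L l) * (\<Sum>j\<in>(\<lambda>k. int (g k)) ` G. ?r ^ nat \<bar>j - int l\<bar>)"
    by (simp add: sum.reindex[OF inj] sum_distrib_left)
  also have "\<dots> \<le> ?B * a (L l) * ((1 + ?r) / (1 - ?r))"
    using B(1) pos[OF L_ge, of l] Q G by (intro mult_left_mono geometric_sum_int_le') auto
  also have "\<dots> \<le> ?B * a T * 3"
    using B(1) pos[OF L_ge, of l] pos[OF T] Q a_mono[OF L_ge l(1)]
    by (intro mult_mono) (auto simp: divide_le_eq)
  finally show ?thesis by (simp add: mult_ac)
qed

section \<open>The lacunary series: upper bound, holomorphy and lower bound\<close>

definition series :: "nat \<Rightarrow> ('n \<Rightarrow> bool \<times> bool) \<Rightarrow> complex ^ 'n \<Rightarrow> complex" where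
  "series p \<sigma> z = (\<Sum>k. a (L (2 * k + p)) * spike (L (2 * k + p)) \<sigma> z)"

text \<open>A radius \<open>R\<close> in place of \<open>norm z\<close> gives one dominating
  sequence for a whole ball, and also covers points too near the centre for the scale to reach
  \<open>N0\<close>.\<close>

lemma norm_series_term_le:
  fixes z :: "complex ^ 'n"
  assumes z: "norm z \<le> R" and R: "R < 1"
  shows "norm (a (L j) * spike (L j) \<sigma> z) \<le> 9 ^ CARD('n) * (a (L j) * exp (- L j / (1 / (1 - R)) / 2))"
proof -
  have "(norm z)\<^sup>2 \<le> norm z" using z R by (simp add: power2_eq_square mult_left_le_one_le)
  then have "(norm z)\<^sup>2 \<le> R" using z by linarith
  then have "L j * (1 - R) \<le> L j * (1 - (norm z)\<^sup>2)" using L_pos[of j] by (intro mult_left_mono) auto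
  then have "exp (- L j * (1 - (norm z)\<^sup>2) / 2) \<le> exp (- L j / (1 / (1 - R)) / 2)" by simp
  then have "norm (spike (L j) \<sigma> z) \<le> 9 ^ CARD('n) * exp (- L j / (1 / (1 - R)) / 2)"
    using norm_spike_le[of "L j" \<sigma> z] L_pos[of j] mult_left_mono[of _ _ "9 ^ CARD('n)"]
    by (smt (verit) zero_le_power)
  then show ?thesis
    using mult_left_mono[of _ _ "a (L j)"] pos[OF L_ge, of j] by (simp add: norm_mult mult.left_commute)
qed

lemma summable_series_bound:
  assumes T: "N0 \<le> T"
  shows "summable (\<lambda>k. a (L (2 * k + p)) * exp (- L (2 * k + p) / T / 2))" (is ?A)
    and "(\<Sum>k. a (L (2 * k + p)) * exp (- L (2 * k + p) / T / 2)) \<le> 3 * B * Q powr (\<alpha> + \<beta>) * a T" (is ?B)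
proof -
  have le: "(\<Sum>k<n. a (L (2 * k + p)) * exp (- L (2 * k + p) / T / 2)) \<le> 3 * B * Q powr (\<alpha> + \<beta>) * a T" for n
    using T by (intro sum_terms_le') (auto simp: inj_on_def)
  show ?A using pos[OF L_ge] by (intro summableI_nonneg_bounded[OF _ le]) (auto intro: less_imp_le)
  then show ?B using le by (rule suminf_le_const)
qed

lemma norm_series_le:
  fixes z :: "complex ^ 'n"
  assumes z: "norm z \<le> R" and R: "R < 1" "N0 \<le> 1 / (1 - R)"
  shows "norm (series p \<sigma> z) \<le> 9 ^ CARD('n) * (3 * B * Q powr (\<alpha> + \<beta>)) * a (1 / (1 - R))"
proof -
  note sb = summable_series_bound[OF R(2), of p]
  have "norm (series p \<sigma> z)
      \<le> (\<Sum>k. 9 ^ CARD('n) * (a (L (2 * k + p)) * exp (- L (2 * k + p) / (1 / (1 - R)) / 2)))"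
    unfolding series_def using norm_series_term_le[OF z R(1)] sb(1)
    by (intro norm_suminf_le summable_mult) auto
  also have "\<dots> = 9 ^ CARD('n) * (\<Sum>k. a (L (2 * k + p)) * exp (- L (2 * k + p) / (1 / (1 - R)) / 2))"
    by (intro suminf_mult sb)
  also have "\<dots> \<le> 9 ^ CARD('n) * (3 * B * Q powr (\<alpha> + \<beta>) * a (1 / (1 - R)))"
    by (intro mult_left_mono sb) auto
  finally show ?thesis by (simp add: mult_ac)
qed

lemma holomorphic_series:
  fixes \<sigma> :: "'n :: finite \<Rightarrow> bool \<times> bool"
  shows "series p \<sigma> holomorphic_vec_on ball 0 1"
  unfolding series_def[abs_def]
proof (rule holomorphic_vec_on_suminf)
  show "(\<lambda>z. a (L (2 * k + p)) * spike (L (2 * k + p)) \<sigma> z) holomorphic_vec_on ball 0 1" for k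
    by (intro holomorphic_vec_on_mult holomorphic_vec_on_const holomorphic_spike)
next
  fix z :: "complex ^ 'n" assume z: "z \<in> ball 0 1"
  \<comment> \<open>The first entry bounds the norm on the ball around \<open>z\<close> of half the
    distance to the sphere; the second ensures that the scale \<open>1 / (1 - R)\<close> reaches
    \<open>N0\<close>.\<close>
  define R where "R = max ((1 + norm z) / 2) (1 - 1 / N0)"
  have R: "R < 1" using z N0 by (simp add: R_def)
  have "1 - 1 / N0 \<le> R" by (simp add: R_def)
  then have "N0 \<le> 1 / (1 - R)" using N0 R by (simp add: field_simps)
  then have "summable (\<lambda>k. 9 ^ CARD('n) * (a (L (2 * k + p)) * exp (- L (2 * k + p) / (1 / (1 - R)) / 2)))"
    by (intro summable_mult summable_series_bound)
  moreover have w_le: "norm w \<le> R" if "w \<in> ball z ((1 - norm z) / 2)" for w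
  proof -
    have "norm (w - z) < (1 - norm z) / 2" using that by (simp add: dist_norm norm_minus_commute)
    then have "norm w \<le> (1 + norm z) / 2" using norm_triangle_ineq[of z "w - z"] by simp
    then show ?thesis by (simp add: R_def le_max_iff_disj)
  qed
  moreover have "ball z ((1 - norm z) / 2) \<subseteq> ball 0 1"
    using w_le R by fastforce
  moreover have "0 < (1 - norm z) / 2" using z by simp
  ultimately show "\<exists>r b. 0 < r \<and> ball z r \<subseteq> ball 0 1 \<and> summable b \<and>
      (\<forall>k. \<forall>w\<in>ball z r. norm (complex_of_real (a (L (2 * k + p))) * spike (L (2 * k + p)) \<sigma> w) \<le> b k)"
    using norm_series_term_le[OF w_le R] by blast
qed

text \<open>The parity of the scale index \<open>l\<close> selects a series that contains the term
  at \<open>l\<close> and skips \<open>Suc l\<close>. \<open>Q_large\<close> keeps the other terms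
  below half of the lower bound for this one.\<close>

lemma norm_series_ge:
  fixes z :: "complex ^ 'n"
  assumes z: "norm z < 1" "N0 \<le> 1 / (1 - norm z)"
    and Q_large: "9 ^ CARD('n) * (4 * B * Q powr - \<alpha>) \<le> (1 / 16) ^ CARD('n) * exp (- 1) / 2"
  shows "\<exists>p\<in>{0,1}. \<exists>\<sigma>. (1 / 16) ^ CARD('n) * exp (- 1) / 2 * Q powr - \<beta> * a (1 / (1 - norm z))
    \<le> norm (series p \<sigma> z)"
proof -
  define T where "T = 1 / (1 - norm z)"
  define c where "c = (1 / 16 :: real) ^ CARD('n) * exp (- 1)"
  obtain l where l: "L l \<le> T" "T \<le> L (Suc l)" using ex_scale z(2) unfolding T_def by blast
  have T: "0 < T" "N0 \<le> T" using z by (auto simp: T_def)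
  have c: "0 < c" by (simp add: c_def)
  have al: "0 < a (L l)" by (intro pos L_ge)
  define p where "p = l mod 2"
  define k where "k = l div 2"
  have lk: "2 * k + p = l" by (simp add: p_def k_def)
  obtain \<sigma> where \<sigma>: "(1 / 16) ^ CARD('n) * exp (- L l * (1 - (norm z)\<^sup>2) / 2) \<le> norm (spike (L l) \<sigma> z)"
    using norm_spike_ge[of "L l" z] L_pos[of l] z by auto
  \<comment> \<open>At the dominant scale the exponent of the spike is bounded: 1 - |z|^2 is at most
    2(1 - |z|), and L l (1 - |z|) is at most 1. This gives the factor
    \<open>exp (- 1)\<close>.\<close>
  have "L l * (1 - norm z) \<le> T * (1 - norm z)" using l z by (intro mult_right_mono) auto
  then have "L l * (1 - norm z) \<le> 1" using z by (simp add: T_def)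
  moreover have "1 - (norm z)\<^sup>2 \<le> 2 * (1 - norm z)"
    using zero_le_power2[of "1 - norm z"] by (simp add: power2_eq_square algebra_simps)
  then have "L l * (1 - (norm z)\<^sup>2) \<le> L l * (2 * (1 - norm z))"
    using L_pos[of l] by (intro mult_left_mono) auto
  moreover have "L l * (2 * (1 - norm z)) = 2 * (L l * (1 - norm z))" by simp
  ultimately have "L l * (1 - (norm z)\<^sup>2) \<le> 2" by linarith
  then have exp_ge: "exp (- 1) \<le> exp (- L l * (1 - (norm z)\<^sup>2) / 2)" by simp
  have "c \<le> norm (spike (L l) \<sigma> z)"
    unfolding c_def by (rule order_trans[OF mult_left_mono[OF exp_ge] \<sigma>]) simp
  then have main: "a (L l) * c \<le> norm (a (L l) * spike (L l) \<sigma> z)"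
    using al by (simp add: norm_mult)
  define u where "u k = a (L (2 * k + p)) * spike (L (2 * k + p)) \<sigma> z" for k
  have u_le: "norm (u i) \<le> 9 ^ CARD('n) * (a (L (2 * i + p)) * exp (- L (2 * i + p) / T / 2))" for i
    unfolding u_def T_def using z by (intro norm_series_term_le) auto
  have rest: "(\<Sum>i\<in>G. norm (u i)) \<le> c / 2 * a (L l)" if G: "finite G" "k \<notin> G" for G
  proof -
    have "(\<Sum>i\<in>G. norm (u i)) \<le> 9 ^ CARD('n) * (\<Sum>i\<in>G. a (L (2 * i + p)) * exp (- L (2 * i + p) / T / 2))"
      unfolding sum_distrib_left by (intro sum_mono u_le)
    also have "\<dots> \<le> 9 ^ CARD('n) * (4 * B * Q powr - \<alpha> * a (L l))"
    proof (intro mult_left_mono sum_terms_le[OF l])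
      show "2 * i + p \<noteq> l \<and> 2 * i + p \<noteq> Suc l" if "i \<in> G" for i
      proof -
        have "i \<noteq> k" using that G by auto
        then show ?thesis using lk by presburger
      qed
    qed (use G in \<open>auto simp: inj_on_def\<close>)
    also have "\<dots> \<le> c / 2 * a (L l)"
      using mult_right_mono[OF Q_large, of "a (L l)"] al by (simp add: c_def mult_ac)
    finally show ?thesis .
  qed
  have "summable u"
    using u_le by (intro summable_comparison_test'[OF summable_mult[OF summable_series_bound(1)[OF T(2)]]])
  from norm_suminf_ge[OF this rest] have "norm (u k) - c / 2 * a (L l) \<le> norm (series p \<sigma> z)"
    unfolding series_def u_def by blast
  then have *: "c / 2 * a (L l) \<le> norm (series p \<sigma> z)"
    using main lk by (simp add: u_def mult.commute)
  \<comment> \<open>Passing from \<open>L l\<close> to the true scale \<open>T\<close> costs at most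
    Q^\<beta>, since T / L l is at most \<open>Q\<close>.\<close>
  have "a T \<le> a (L l) * (T / L l) powr \<beta>" by (intro growth_le L_ge l)
  also have "\<dots> \<le> a (L l) * Q powr \<beta>"
  proof (intro mult_left_mono powr_mono2)
    show "T / L l \<le> Q" using l L_pos[of l] by (simp add: divide_le_eq L_def mult_ac)
  qed (use al exponents T L_pos[of l] in auto)
  finally have "Q powr - \<beta> * a T \<le> a (L l)"
    using Q by (simp add: powr_minus field_simps)
  then have "c / 2 * (Q powr - \<beta> * a T) \<le> c / 2 * a (L l)" using c by (intro mult_left_mono) auto
  with * have "c / 2 * Q powr - \<beta> * a T \<le> norm (series p \<sigma> z)" by (simp add: mult_ac)
  moreover have "p \<in> {0, 1}" by (auto simp: p_def)
  ultimately show ?thesis unfolding c_def T_def by blast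
qed

end

subsection \<open>Normal weights\<close>

text \<open>Under the substitution \<open>x = 1 / (1 - r)\<close> these two comparisons become the
  growth conditions of \<open>lacunary_growth\<close>.\<close>

lemma normal_weight_growth:
  assumes "normal_weight \<mu>"
  obtains \<alpha> \<beta> \<delta> where "0 < \<alpha>" "0 < \<beta>" "0 < \<delta>" "\<delta> < 1"
    and "\<And>r s. \<delta> \<le> r \<Longrightarrow> r \<le> s \<Longrightarrow> s < 1 \<Longrightarrow> \<mu> s \<le> \<mu> r * ((1 - s) / (1 - r)) powr \<alpha>"
    and "\<And>r s. \<delta> \<le> r \<Longrightarrow> r \<le> s \<Longrightarrow> s < 1 \<Longrightarrow> \<mu> r \<le> \<mu> s * ((1 - r) / (1 - s)) powr \<beta>"
proof -
  obtain \<alpha> \<beta> \<delta> where *: "0 < \<alpha>" "\<alpha> < \<beta>" "0 < \<delta>" "\<delta> < 1"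
    and anti: "antimono_on {\<delta>..<1} (\<lambda>r. \<mu> r / (1 - r) powr \<alpha>)"
    and mono: "mono_on {\<delta>..<1} (\<lambda>r. \<mu> r / (1 - r) powr \<beta>)"
    using assms unfolding normal_weight_def by blast
  show ?thesis
  proof (rule that[of \<alpha> \<beta> \<delta>])
    fix r s assume rs: "\<delta> \<le> r" "r \<le> s" "s < 1"
    have "\<mu> s / (1 - s) powr \<alpha> \<le> \<mu> r / (1 - r) powr \<alpha>"
      using rs by (intro monotone_onD[OF anti]) auto
    then show "\<mu> s \<le> \<mu> r * ((1 - s) / (1 - r)) powr \<alpha>"
      using rs by (simp add: powr_divide field_simps)
    have "\<mu> r / (1 - r) powr \<beta> \<le> \<mu> s / (1 - s) powr \<beta>"
      using rs by (intro monotone_onD[OF mono]) auto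
    then show "\<mu> r \<le> \<mu> s * ((1 - r) / (1 - s)) powr \<beta>"
      using rs by (simp add: powr_divide field_simps)
  qed (use * in auto)
qed

lemma in_weighted_Hinf:
  fixes f :: "complex ^ 'n \<Rightarrow> complex"
  assumes "f holomorphic_vec_on ball 0 1" "\<And>z. norm z < 1 \<Longrightarrow> \<mu> (norm z) * norm (f z) \<le> b"
  shows "f \<in> weighted_Hinf \<mu>"
proof -
  have "weighted_norm \<mu> f \<le> ereal b"
    unfolding weighted_norm_def using assms(2) by (intro SUP_least) auto
  then show ?thesis
    using assms(1) unfolding weighted_Hinf_def by (auto intro: le_less_trans)
qed

lemma ex_indexed_family:
  assumes \<mu>: "normal_weight \<mu>"
  shows "\<exists>(F :: (bool \<times> ('n :: finite \<Rightarrow> bool \<times> bool)) option \<Rightarrow> complex ^ 'n \<Rightarrow> complex) C.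
    (\<forall>i. F i \<in> weighted_Hinf \<mu>) \<and> 0 < C \<and> (\<forall>z\<in>ball 0 1. \<exists>i. C / \<mu> (norm z) \<le> norm (F i z))"
proof -
  obtain \<alpha> \<beta> \<delta> where ab: "0 < \<alpha>" "0 < \<beta>" and \<delta>: "0 < \<delta>" "\<delta> < 1"
    and up: "\<And>r s. \<delta> \<le> r \<Longrightarrow> r \<le> s \<Longrightarrow> s < 1 \<Longrightarrow> \<mu> s \<le> \<mu> r * ((1 - s) / (1 - r)) powr \<alpha>"
    and low: "\<And>r s. \<delta> \<le> r \<Longrightarrow> r \<le> s \<Longrightarrow> s < 1 \<Longrightarrow> \<mu> r \<le> \<mu> s * ((1 - r) / (1 - s)) powr \<beta>"
    using normal_weight_growth[OF \<mu>] by metis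
  have \<mu>_pos: "0 < \<mu> r" if "0 \<le> r" "r < 1" for r
    using \<mu> that unfolding normal_weight_def by auto
  have cont: "continuous_on {0..\<delta>} \<mu>"
    using \<mu> \<delta> unfolding normal_weight_def by (auto intro: continuous_on_subset)
  \<comment> \<open>The extrema of \<open>\<mu>\<close> on the compact part [0, \<delta>] supply the
    constants there; \<open>\<mu> m'\<close> even bounds \<open>\<mu>\<close> on all of [0,
    1).\<close>
  obtain m where m: "0 \<le> m" "m \<le> \<delta>" "\<And>r. 0 \<le> r \<Longrightarrow> r \<le> \<delta> \<Longrightarrow> \<mu> m \<le> \<mu> r"
    using continuous_attains_inf[OF _ _ cont] \<delta> by auto
  obtain m' where m': "0 \<le> m'" "m' \<le> \<delta>" "\<And>r. 0 \<le> r \<Longrightarrow> r \<le> \<delta> \<Longrightarrow> \<mu> r \<le> \<mu> m'"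
    using continuous_attains_sup[OF _ _ cont] \<delta> by auto
  have \<mu>_le: "\<mu> r \<le> \<mu> m'" if r: "0 \<le> r" "r < 1" for r
  proof (cases "r \<le> \<delta>")
    case False
    then have "((1 - r) / (1 - \<delta>)) powr \<alpha> \<le> 1" using r \<delta> ab by (intro powr_le1) auto
    then have "\<mu> \<delta> * ((1 - r) / (1 - \<delta>)) powr \<alpha> \<le> \<mu> \<delta>" using \<mu>_pos[of \<delta>] \<delta> by (intro mult_left_le) auto
    then show ?thesis using up[of \<delta> r] m'(3)[of \<delta>] False r \<delta> by linarith
  qed (use r m' in auto)
  define N0 where "N0 = 1 / (1 - \<delta>)"
  define a where "a x = 1 / \<mu> (1 - 1 / x)" for x
  have N0: "0 < N0" using \<delta> by (simp add: N0_def)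
  have range: "0 < x" "\<delta> \<le> 1 - 1 / x" "1 - 1 / x < 1" if "N0 \<le> x" for x
  proof -
    show x: "0 < x" using that N0 by linarith
    show "\<delta> \<le> 1 - 1 / x" "1 - 1 / x < 1" using that x \<delta> by (auto simp: N0_def field_simps)
  qed
  obtain B where B: "1 \<le> B" "\<And>y. 1 \<le> y \<Longrightarrow> y powr (\<alpha> + \<beta>) * exp (- sqrt y / 2) \<le> B"
    using powr_times_exp_sqrt_bounded by blast
  \<comment> \<open>The first entry meets the locale's condition on \<open>Q\<close>, the second the
    hypothesis \<open>Q_large\<close> of \<open>norm_series_ge\<close>. \<open>Q\<close> may depend
    on \<open>\<mu>\<close>; the number of series does not.\<close>
  define \<epsilon> where "\<epsilon> = min (1 / 2) ((1 / 16) ^ CARD('n) * exp (- 1) / 2 / (9 ^ CARD('n) * (4 * B)))"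
  have \<epsilon>: "0 < \<epsilon>" using B(1) by (simp add: \<epsilon>_def)
  have "((\<lambda>Q. Q powr - \<alpha>) \<longlongrightarrow> 0) at_top" using ab by (intro tendsto_neg_powr filterlim_ident) auto
  then have "\<forall>\<^sub>F Q in at_top. Q powr - \<alpha> < \<epsilon>" using \<epsilon> by (rule order_tendstoD)
  with eventually_gt_at_top[of 1] have "\<forall>\<^sub>F Q in at_top. 1 < Q \<and> Q powr - \<alpha> < \<epsilon>"
    by eventually_elim simp
  then obtain Q where Q_large: "1 < Q" "Q powr - \<alpha> < \<epsilon>"
    using eventually_happens'[OF trivial_limit_at_top_linorder] by blast
  interpret lacunary_growth a \<alpha> \<beta> N0 B Q
  proof
    fix x y assume x: "N0 \<le> x" and xy: "x \<le> y"
    note rx = range[OF x] and ry = range[OF order_trans[OF x xy]]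
    have le: "1 - 1 / x \<le> 1 - 1 / y" using rx(1) xy by (simp add: frac_le)
    have \<mu>x: "0 < \<mu> (1 - 1 / x)" "0 < \<mu> (1 - 1 / y)" by (rule \<mu>_pos; use rx ry \<delta> in linarith)+
    have "\<mu> (1 - 1 / y) \<le> \<mu> (1 - 1 / x) * (x / y) powr \<alpha>"
      using up[OF rx(2) le ry(3)] by simp
    then show "a x \<le> a y * (x / y) powr \<alpha>" using \<mu>x by (simp add: a_def field_simps)
    have "\<mu> (1 - 1 / x) \<le> \<mu> (1 - 1 / y) * (y / x) powr \<beta>"
      using low[OF rx(2) le ry(3)] by simp
    then show "a y \<le> a x * (y / x) powr \<beta>" using \<mu>x by (simp add: a_def field_simps)
  next
    show "0 < a x" if "N0 \<le> x" for x
      unfolding a_def by (intro divide_pos_pos \<mu>_pos zero_less_one; use range[OF that] \<delta> in linarith)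
    show "Q powr - \<alpha> \<le> 1 / 2" using Q_large by (simp add: \<epsilon>_def)
  qed (use N0 ab B Q_large in auto)
  \<comment> \<open>This includes \<open>r = 1\<close>, where both divisions by zero return
    0.\<close>
  have a_T: "a (1 / (1 - r)) = 1 / \<mu> r" for r by (simp add: a_def)
  have T_ge: "N0 \<le> 1 / (1 - r)" if "\<delta> \<le> r" "r < 1" for r
    using that \<delta> unfolding N0_def by (intro divide_left_mono) auto
  define D where "D = 9 ^ CARD('n) * (3 * B * Q powr (\<alpha> + \<beta>))"
  have D: "0 < D" using B(1) Q by (simp add: D_def)
  have Hinf: "series p \<sigma> \<in> weighted_Hinf \<mu>" for p and \<sigma> :: "'n \<Rightarrow> bool \<times> bool"
  proof (rule in_weighted_Hinf)
    fix z :: "complex ^ 'n" assume z: "norm z < 1"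
    \<comment> \<open>For |z| < \<delta> the series is bounded at radius \<delta> instead, at the
      cost of the ratio of the extrema of \<open>\<mu>\<close> on [0, \<delta>].\<close>
    define R where "R = max \<delta> (norm z)"
    have R: "0 < R" "R < 1" "\<delta> \<le> R" using z \<delta> by (auto simp: R_def)
    have "norm (series p \<sigma> z) \<le> D / \<mu> R"
      using norm_series_le[of z R p \<sigma>] R T_ge[of R] by (simp add: D_def a_T R_def)
    moreover have "\<mu> (norm z) / \<mu> R \<le> \<mu> m' / \<mu> m"
    proof (cases "\<delta> \<le> norm z")
      case True
      then show ?thesis
        using z \<mu>_pos[of "norm z"] \<mu>_pos[of m] m m'(3)[of m] \<delta> by (simp add: R_def max_def)
    next
      case False
      then show ?thesis
        using \<mu>_pos[of "norm z"] \<mu>_pos[of m] \<mu>_pos[of m'] m m' \<delta>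
        by (intro frac_le) (auto simp: R_def)
    qed
    ultimately have "\<mu> (norm z) * norm (series p \<sigma> z) \<le> \<mu> (norm z) * (D / \<mu> R)"
      using \<mu>_pos[of "norm z"] z by (intro mult_left_mono) auto
    also have "\<dots> = D * (\<mu> (norm z) / \<mu> R)" by simp
    also have "\<dots> \<le> D * (\<mu> m' / \<mu> m)"
      using D \<open>\<mu> (norm z) / \<mu> R \<le> \<mu> m' / \<mu> m\<close> by (intro mult_left_mono) auto
    finally show "\<mu> (norm z) * norm (series p \<sigma> z) \<le> D * (\<mu> m' / \<mu> m)" .
  qed (rule holomorphic_series)
  have one: "(\<lambda>z :: complex ^ 'n. 1) \<in> weighted_Hinf \<mu>"
    by (rule in_weighted_Hinf[where b = "\<mu> m'"]) (auto intro: holomorphic_vec_on_const \<mu>_le)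
  \<comment> \<open>\<open>None\<close> is the constant function for |z| < \<delta>; the other
    indices record the parity and the cosets.\<close>
  define F :: "(bool \<times> ('n \<Rightarrow> bool \<times> bool)) option \<Rightarrow> complex ^ 'n \<Rightarrow> complex" where
    "F i = (case i of None \<Rightarrow> \<lambda>z. 1 | Some (p, \<sigma>) \<Rightarrow> series (of_bool p) \<sigma>)" for i
  define c where "c = (1 / 16) ^ CARD('n) * exp (- 1) / 2 * Q powr - \<beta>"
  have c: "0 < c" using Q by (simp add: c_def)
  define C where "C = min c (\<mu> m)"
  show ?thesis
  proof (intro exI[of _ F] exI[of _ C] conjI allI ballI)
    show "F i \<in> weighted_Hinf \<mu>" for i
      using Hinf one by (auto simp: F_def split: option.split)
    show "0 < C" using c \<mu>_pos[of m] m \<delta> by (simp add: C_def)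
    fix z :: "complex ^ 'n" assume "z \<in> ball 0 1"
    then have z: "norm z < 1" by simp
    have \<mu>z: "0 < \<mu> (norm z)" using z by (intro \<mu>_pos) auto
    show "\<exists>i. C / \<mu> (norm z) \<le> norm (F i z)"
    proof (cases "\<delta> \<le> norm z")
      case True
      have "Q powr - \<alpha> \<le> (1 / 16) ^ CARD('n) * exp (- 1) / 2 / (9 ^ CARD('n) * (4 * B))"
        using Q_large by (simp add: \<epsilon>_def)
      then have "9 ^ CARD('n) * (4 * B * Q powr - \<alpha>) \<le> (1 / 16) ^ CARD('n) * exp (- 1) / 2"
        using B(1) by (subst (asm) pos_le_divide_eq) (auto simp: mult_ac)
      from norm_series_ge[OF z T_ge[OF True z] this]
      obtain p \<sigma> where p: "p = 0 \<or> p = 1" and le: "c / \<mu> (norm z) \<le> norm (series p \<sigma> z)"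
        by (auto simp: c_def a_T)
      have "F (Some (p = 1, \<sigma>)) = series p \<sigma>" using p by (auto simp: F_def)
      moreover have "C / \<mu> (norm z) \<le> c / \<mu> (norm z)"
        using \<mu>z by (intro divide_right_mono) (auto simp: C_def)
      ultimately show ?thesis using le by (metis order_trans)
    next
      case False
      then have "C \<le> \<mu> (norm z)" using m(3)[of "norm z"] by (simp add: C_def min.coboundedI2)
      then show ?thesis using \<mu>z by (intro exI[of _ None]) (simp add: F_def)
    qed
  qed
qed

section \<open>Enumeration of the finite family\<close>

theorem theorem3p1:
  "\<exists>M::nat. M > 0 \<and>
     (\<forall>\<mu>. normal_weight \<mu> \<longrightarrow>
        (\<exists>(f :: nat \<Rightarrow> complex ^ 'n \<Rightarrow> complex) (C::real).
           (\<forall>i\<in>{1..M}. f i \<in> weighted_Hinf \<mu>) \<and> C > 0 \<and>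
           (\<forall>z\<in>ball 0 1. (\<Sum>i=1..M. norm (f i z)) \<ge> C / \<mu> (norm z))))"
proof -
  \<comment> \<open>The index type involves only the dimension, so its cardinality can be fixed
    before \<open>\<mu>\<close>.\<close>
  let ?I = "UNIV :: (bool \<times> ('n \<Rightarrow> bool \<times> bool)) option set"
  obtain h where h: "bij_betw h {1..card ?I} ?I"
    using ex_bij_betw_nat_finite_1[of ?I] by auto
  show ?thesis
  proof (intro exI[of _ "card ?I"] conjI allI impI)
    show "0 < card ?I" by (simp add: card_gt_0_iff)
    fix \<mu> assume "normal_weight \<mu>"
    then obtain F :: "(bool \<times> ('n \<Rightarrow> bool \<times> bool)) option \<Rightarrow> complex ^ 'n \<Rightarrow> complex" and C
      where F: "\<And>i. F i \<in> weighted_Hinf \<mu>" and C: "0 < C"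
        and ge: "\<And>z. z \<in> ball 0 1 \<Longrightarrow> \<exists>i. C / \<mu> (norm z) \<le> norm (F i z)"
      using ex_indexed_family[OF \<open>normal_weight \<mu>\<close>, where 'n = 'n] by metis
    show "\<exists>(f :: nat \<Rightarrow> complex ^ 'n \<Rightarrow> complex) (C::real).
           (\<forall>i\<in>{1..card ?I}. f i \<in> weighted_Hinf \<mu>) \<and> C > 0 \<and>
           (\<forall>z\<in>ball 0 1. (\<Sum>i=1..card ?I. norm (f i z)) \<ge> C / \<mu> (norm z))"
    proof (intro exI[of _ "\<lambda>i. F (h i)"] exI[of _ C] conjI ballI)
      fix z :: "complex ^ 'n" assume "z \<in> ball 0 1"
      then obtain i where "C / \<mu> (norm z) \<le> norm (F i z)" using ge by blast
      also have "\<dots> \<le> (\<Sum>i\<in>UNIV. norm (F i z))" by (rule member_le_sum) auto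
      also have "\<dots> = (\<Sum>i=1..card ?I. norm (F (h i) z))"
        by (rule sum.reindex_bij_betw[OF h, symmetric])
      finally show "C / \<mu> (norm z) \<le> (\<Sum>i=1..card ?I. norm (F (h i) z))" .
    qed (use F C in auto)
  qed
qed

end
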